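(* Let $k$ be a field and $V$ a nonzero $k$-vector space. The following are equivalent for any $T \in \mathrm{End}_k(V)$. (1) $T$ is topologically nilpotent with respect to the function topology on $\mathrm{End}_k(V)$; that is, the sequence $(T^i)_{i=1}^\infty$ converges to $0$. (2) $V = \bigcup_{i=1}^\infty \ker (T^i)$. (3) $T$ is strictly triangularizable. (4) $T$ is triangularizable, and if $(\mathcal{B}, \leq)$ is a well-ordered basis for $V$ with respect to which $T$ is triangular, then $T$ is strictly triangular with respect to $(\mathcal{B}, \leq)$. (5) $T$ is triangularizable, and for all $a \in k$, $\ker(T-aI) \neq 0$ if and only if $a=0$, where $I \in \mathrm{End}_k(V)$ is the identity transformation.
   Context: $V$ has arbitrary nonzero dimension. $\mathrm{End}_k(V)$ is the $k$-algebra of all linear transformations of $V$, and $\langle X\rangle$ is the subspace generated by $X$. Given a basis $\mathcal{B}$ for $V$ and a partial order $\leq$ on $\mathcal{B}$, $T \in \mathrm{End}_k(V)$ is triangular with respect to $(\mathcal{B}, \leq)$ if $T(v) \in \langle \{u \in \mathcal{B} \mid u \leq v\} \rangle$ for all $v \in \mathcal{B}$, and strictly triangular with respect to $(\mathcal{B}, \leq)$ if $T(v) \in \langle \{u \in \mathcal{B} \mid u < v\} \rangle$ for all $v \in \mathcal{B}$. $T$ is triangularizable (respectively strictly triangularizable) if it is triangular (respectively strictly triangular) with respect to some well-ordered basis for $V$. The function topology on $\mathrm{End}_k(V)$ is the topology having as a base of open sets the sets $\{S \in \mathrm{End}_k(V) \mid S|_W=T|_W\}$, for $T \in \mathrm{End}_k(V)$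 and $W \subseteq V$ a finite-dimensional subspace. *)

theory Defs
  imports "HOL-Analysis.Analysis"
begin

text \<open>
  The scalar field is a type \<open>'k\<close> of class \<open>field\<close>, and the vector space \<open>V\<close> is a whole type
  \<open>'v\<close> together with a scalar multiplication \<open>scl\<close> satisfying \<^locale>\<open>vector_space\<close>.
\<close>

definition End :: "('k::field \<Rightarrow> 'v::ab_group_add \<Rightarrow> 'v) \<Rightarrow> ('v \<Rightarrow> 'v) set" where
  "End scl = {T. Vector_Spaces.linear scl scl T}"

definition ker :: "('v \<Rightarrow> 'v::zero) \<Rightarrow> 'v set" where
  "ker T = {v. T v = 0}"

definition fin_dim_subspace :: "('k::field \<Rightarrow> 'v::ab_group_add \<Rightarrow> 'v) \<Rightarrow> 'v set \<Rightarrow> bool" where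
  "fin_dim_subspace scl W \<longleftrightarrow>
     module.subspace scl W \<and> (\<exists>X. finite X \<and> module.span scl X = W)"

definition function_topology_base ::
    "('k::field \<Rightarrow> 'v::ab_group_add \<Rightarrow> 'v) \<Rightarrow> ('v \<Rightarrow> 'v) set \<Rightarrow> bool" where
  "function_topology_base scl U \<longleftrightarrow>
     (\<exists>T\<in>End scl. \<exists>W. fin_dim_subspace scl W \<and> U = {S \<in> End scl. \<forall>w\<in>W. S w = T w})"

definition function_topology ::
    "('k::field \<Rightarrow> 'v::ab_group_add \<Rightarrow> 'v) \<Rightarrow> ('v \<Rightarrow> 'v) topology" where
  "function_topology scl = topology (arbitrary union_of (function_topology_base scl))"

text \<open>The sequence of powers starts with exponent 1.\<close>

definition topologically_nilpotent :: "('v \<Rightarrow> 'v::zero) topology \<Rightarrow> ('v \<Rightarrow> 'v) \<Rightarrow> bool" where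
  "topologically_nilpotent X T \<longleftrightarrow> limitin X (\<lambda>i. T ^^ Suc i) (\<lambda>v. 0) sequentially"

definition is_basis :: "('k::field \<Rightarrow> 'v::ab_group_add \<Rightarrow> 'v) \<Rightarrow> 'v set \<Rightarrow> bool" where
  "is_basis scl B \<longleftrightarrow> \<not> module.dependent scl B \<and> module.span scl B = UNIV"

text \<open>Orders are reflexive relations, with \<open>(u, v) \<in> r\<close> meaning \<open>u \<le> v\<close>.\<close>

definition well_ordered_basis ::
    "('k::field \<Rightarrow> 'v::ab_group_add \<Rightarrow> 'v) \<Rightarrow> 'v set \<Rightarrow> 'v rel \<Rightarrow> bool" where
  "well_ordered_basis scl B r \<longleftrightarrow> is_basis scl B \<and> well_order_on B r"

text \<open>The next two notions are meant for a basis \<open>B\<close> and a partial order \<open>r\<close> on \<open>B\<close>.\<close>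

definition triangular ::
    "('k::field \<Rightarrow> 'v::ab_group_add \<Rightarrow> 'v) \<Rightarrow> 'v set \<Rightarrow> 'v rel \<Rightarrow> ('v \<Rightarrow> 'v) \<Rightarrow> bool" where
  "triangular scl B r T \<longleftrightarrow> (\<forall>v\<in>B. T v \<in> module.span scl {u \<in> B. (u, v) \<in> r})"

definition strictly_triangular ::
    "('k::field \<Rightarrow> 'v::ab_group_add \<Rightarrow> 'v) \<Rightarrow> 'v set \<Rightarrow> 'v rel \<Rightarrow> ('v \<Rightarrow> 'v) \<Rightarrow> bool" where
  "strictly_triangular scl B r T \<longleftrightarrow>
     (\<forall>v\<in>B. T v \<in> module.span scl {u \<in> B. (u, v) \<in> r \<and> u \<noteq> v})"

definition triangularizable ::
    "('k::field \<Rightarrow> 'v::ab_group_add \<Rightarrow> 'v) \<Rightarrow> ('v \<Rightarrow> 'v) \<Rightarrow> bool" where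
  "triangularizable scl T \<longleftrightarrow>
     (\<exists>B r. well_ordered_basis scl B r \<and> triangular scl B r T)"

definition strictly_triangularizable ::
    "('k::field \<Rightarrow> 'v::ab_group_add \<Rightarrow> 'v) \<Rightarrow> ('v \<Rightarrow> 'v) \<Rightarrow> bool" where
  "strictly_triangularizable scl T \<longleftrightarrow>
     (\<exists>B r. well_ordered_basis scl B r \<and> strictly_triangular scl B r T)"

text \<open>
  The constant \<^const>\<open>topology\<close> is only meaningful on predicates satisfying \<^const>\<open>istopology\<close>;
  the following lemmas show that this is the case here.
\<close>

lemma fin_dim_subspace_sum:
  assumes "vector_space scl" "fin_dim_subspace scl W1" "fin_dim_subspace scl W2"
  shows "\<exists>W. fin_dim_subspace scl W \<and> W1 \<union> W2 \<subseteq> W"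
proof -
  interpret vector_space scl by fact
  obtain X where X: "finite X" "span X = W1"
    using assms(2) unfolding fin_dim_subspace_def by blast
  obtain Y where Y: "finite Y" "span Y = W2"
    using assms(3) unfolding fin_dim_subspace_def by blast
  have "fin_dim_subspace scl (span (X \<union> Y))"
    unfolding fin_dim_subspace_def using X(1) Y(1) subspace_span by blast
  moreover have "W1 \<union> W2 \<subseteq> span (X \<union> Y)"
    using X(2) Y(2) span_mono[of X "X \<union> Y"] span_mono[of Y "X \<union> Y"] by blast
  ultimately show ?thesis by blast
qed

lemma openin_function_topology:
  assumes "vector_space scl"
  shows "openin (function_topology scl) = arbitrary union_of (function_topology_base scl)"
proof -
  let ?P = "function_topology_base scl"
  have "(arbitrary union_of ?P) (A \<inter> B)" if A: "?P A" and B: "?P B" for A B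
  proof -
    obtain T1 W1 where 1: "fin_dim_subspace scl W1" "A = {S \<in> End scl. \<forall>w\<in>W1. S w = T1 w}"
      using A unfolding function_topology_base_def by blast
    obtain T2 W2 where 2: "fin_dim_subspace scl W2" "B = {S \<in> End scl. \<forall>w\<in>W2. S w = T2 w}"
      using B unfolding function_topology_base_def by blast
    obtain W where W: "fin_dim_subspace scl W" "W1 \<union> W2 \<subseteq> W"
      using fin_dim_subspace_sum[OF assms 1(1) 2(1)] by blast
    have "\<exists>U. ?P U \<and> S \<in> U \<and> U \<subseteq> A \<inter> B" if S: "S \<in> A \<inter> B" for S
    proof (intro exI conjI)
      let ?U = "{R \<in> End scl. \<forall>w\<in>W. R w = S w}"
      have S': "S \<in> End scl" "\<forall>w\<in>W1. S w = T1 w" "\<forall>w\<in>W2. S w = T2 w"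
        using S 1(2) 2(2) by blast+
      show "?P ?U"
        unfolding function_topology_base_def using S'(1) W(1) by blast
      show "S \<in> ?U"
        using S'(1) by simp
      show "?U \<subseteq> A \<inter> B"
      proof
        fix R
        assume "R \<in> ?U"
        then have "R \<in> End scl" "\<forall>w\<in>W1. R w = T1 w" "\<forall>w\<in>W2. R w = T2 w"
          using W(2) S'(2,3) by (auto simp: subset_iff)
        then show "R \<in> A \<inter> B"
          unfolding 1(2) 2(2) by blast
      qed
    qed
    then show ?thesis
      unfolding arbitrary_union_of_alt by blast
  qed
  then have "istopology (arbitrary union_of ?P)"
    unfolding istopology_base_eq by blast
  then show ?thesis
    unfolding function_topology_def by (rule topology_inverse')
qed

lemma topspace_function_topology:
  assumes "vector_space scl"
  shows "topspace (function_topology scl) = End scl"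
proof (rule subset_antisym)
  interpret vector_space scl by fact
  show "topspace (function_topology scl) \<subseteq> End scl"
  proof
    fix T
    assume "T \<in> topspace (function_topology scl)"
    then obtain U where "(arbitrary union_of (function_topology_base scl)) U" "T \<in> U"
      unfolding topspace_def openin_function_topology[OF assms] by blast
    then obtain U' where "function_topology_base scl U'" "T \<in> U'"
      unfolding arbitrary_union_of_alt by blast
    then show "T \<in> End scl"
      unfolding function_topology_base_def by blast
  qed
  have fd: "fin_dim_subspace scl {0}"
    unfolding fin_dim_subspace_def using span_empty subspace_single_0 by blast
  show "End scl \<subseteq> topspace (function_topology scl)"
  proof
    fix T
    assume T: "T \<in> End scl"
    let ?U = "{S \<in> End scl. \<forall>w\<in>{0}. S w = T w}"
    have "function_topology_base scl ?U"
      unfolding function_topology_base_def using T fd by blast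
    then have "openin (function_topology scl) ?U"
      unfolding openin_function_topology[OF assms] arbitrary_union_of_alt by blast
    moreover have "T \<in> ?U"
      using T by simp
    ultimately show "T \<in> topspace (function_topology scl)"
      using openin_subset by blast
  qed
qed

end

theory Submission
  imports Defs
begin

text \<open>
  A basis adapted to the filtration \<open>ker T \<subseteq> ker T\<^sup>2 \<subseteq> \<dots>\<close>, ordered by first annihilating power, makes
  a locally nilpotent \<open>T\<close> strictly triangular; conversely strict triangularity gives local
  nilpotence by induction along the basis. For (5) \<open>\<Longrightarrow>\<close> (2), suppose that all basis vectors below \<open>v\<close>
  are killed by powers of \<open>T\<close> and \<open>T v = a v + w\<close> with \<open>a \<noteq> 0\<close>. Then \<open>T - a I\<close> is surjective on the
  locally nilpotent span of the vectors below \<open>v\<close>, so \<open>w = (T - a I) s\<close> there, and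
  \<open>v - s\<close> is an eigenvector for \<open>a\<close>.
\<close>

section \<open>Well-orders on a set and on a basis\<close>

lemma well_order_on_refine_rank:
  fixes f :: "'a \<Rightarrow> 'b::wellorder"
  obtains r where "well_order_on B r" "\<And>u v. u \<in> B \<Longrightarrow> v \<in> B \<Longrightarrow> f u < f v \<Longrightarrow> (u, v) \<in> r"
proof -
  obtain w :: "'a rel" where w: "well_order_on UNIV w"
    using well_order_on by blast
  then have w': "refl w" "trans w" "antisym w" "total w" "wf (w - Id)"
    by (simp_all add: order_on_defs)
  \<comment> \<open>The rank \<open>f\<close> decides first; ties are broken by an arbitrary
    well-order of the whole type, so nothing about the fibres of \<open>f\<close> has to be
    known.\<close>
  define r where "r = {(u, v). u \<in> B \<and> v \<in> B \<and> (f u < f v \<or> f u = f v \<and> (u, v) \<in> w)}"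
  \<comment> \<open>The strict part of \<open>r\<close> embeds into a lexicographic product along
    \<open>u\<close> \<mapsto> \<open>(f u, u)\<close>, which gives well-foundedness at
    once.\<close>
  have "wf (inv_image ({(x, y). x < y} <*lex*> (w - Id)) (\<lambda>u. (f u, u)))"
    by (intro wf_inv_image wf_lex_prod wf w')
  then have "wf (r - Id)"
    by (rule wf_subset) (auto simp: r_def)
  moreover have "refl_on B r" "r \<subseteq> B \<times> B"
    using w'(1) by (auto simp: r_def refl_on_def)
  moreover have "trans r"
    by (rule transI) (use w'(2) in \<open>auto simp: r_def dest: transD\<close>)
  moreover have "antisym r"
    by (rule antisymI) (use w'(3) in \<open>auto simp: r_def dest: antisymD\<close>)
  moreover have "total_on B r"
    using w'(4) by (auto simp: r_def total_on_def)
  ultimately have "well_order_on B r"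
    unfolding order_on_defs by blast
  then show ?thesis
    by (rule that) (simp add: r_def)
qed

lemma well_ordered_basis_insert:
  assumes "well_ordered_basis scl B r" "v \<in> B"
  shows "{u \<in> B. (u, v) \<in> r} = insert v {u \<in> B. (u, v) \<in> r \<and> u \<noteq> v}"
  using assms by (auto simp: well_ordered_basis_def order_on_defs refl_on_def)

lemma well_ordered_basis_induct [consumes 2, case_names less]:
  assumes "well_ordered_basis scl B r" "v \<in> B"
    and step: "\<And>v. v \<in> B \<Longrightarrow> (\<And>u. u \<in> B \<Longrightarrow> (u, v) \<in> r \<Longrightarrow> u \<noteq> v \<Longrightarrow> P u) \<Longrightarrow> P v"
  shows "P v"
proof -
  have "wf (r - Id)"
    using assms(1) by (auto simp: well_ordered_basis_def well_order_on_def)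
  then have "v \<in> B \<longrightarrow> P v"
    by (induction v rule: wf_induct_rule) (use step in auto)
  with assms(2) show ?thesis
    by blast
qed

section \<open>Bases adapted to an increasing filtration\<close>

context vector_space
begin

text \<open>Maximal independent subsets \<open>C n\<close> of \<open>V n\<close> are chosen
  recursively, each extending the previous one. Their union is a directed union of independent sets,
  hence independent, and its intersection with \<open>V n\<close> contains \<open>C n\<close>, which
  already spans \<open>V n\<close>.\<close>

lemma basis_of_filtration:
  fixes V :: "nat \<Rightarrow> 'b set"
  assumes mono: "\<And>n. V n \<subseteq> V (Suc n)" and cover: "(\<Union>n. V n) = UNIV"
  obtains B where "is_basis scale B" "\<And>n. V n \<subseteq> span (B \<inter> V n)"
proof -
  let ?P = "\<lambda>n C. C \<subseteq> V n \<and> independent C \<and> V n \<subseteq> span C"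
  have "\<exists>C. ?P 0 C"
    using maximal_independent_subset[of "V 0"] by metis
  moreover have "\<exists>D. ?P (Suc n) D \<and> C \<subseteq> D" if "?P n C" for n C
    using maximal_independent_subset_extend[of C "V (Suc n)"] that mono[of n]
    by (metis order_trans)
  ultimately obtain C where C: "\<And>n. ?P n (C n)" "\<And>n. C n \<subseteq> C (Suc n)"
    using dependent_nat_choice[of ?P "\<lambda>_ C D. C \<subseteq> D"] by metis
  have "independent (\<Union>(range C))"
  proof (rule independent_Union_directed)
    show "D \<subseteq> E \<or> E \<subseteq> D" if "D \<in> range C" "E \<in> range C" for D E
      using that lift_Suc_mono_le[of C, OF C(2)] by (metis imageE nat_le_linear)
  qed (use C in auto)
  moreover have sub: "V n \<subseteq> span (\<Union>(range C) \<inter> V n)" for n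
  proof -
    have "C n \<subseteq> \<Union>(range C) \<inter> V n"
      using C(1)[of n] by blast
    then show ?thesis
      using C(1)[of n] span_mono by blast
  qed
  moreover have "span (\<Union>(range C)) = UNIV"
  proof -
    have "V n \<subseteq> span (\<Union>(range C))" for n
      using sub[of n] span_mono[of "\<Union>(range C) \<inter> V n" "\<Union>(range C)"] by blast
    with cover show ?thesis
      by blast
  qed
  ultimately show ?thesis
    using that unfolding is_basis_def by blast
qed

end

section \<open>Local nilpotence and the kernels of powers\<close>

locale endomorphism = Vector_Spaces.linear scl scl T
  for scl :: "'k::field \<Rightarrow> 'v::ab_group_add \<Rightarrow> 'v" and T :: "'v \<Rightarrow> 'v"
begin

definition locally_nilpotent :: bool where
  "locally_nilpotent \<longleftrightarrow> (\<forall>v. \<exists>n. (T ^^ n) v = 0)"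

text \<open>The generalized eigenspace for 0. Being a subspace closed under preimages of
  \<open>T\<close>, it allows local nilpotence to be proved one basis vector at a time.\<close>

definition nil_part :: "'v set" where
  "nil_part = {v. \<exists>n. (T ^^ n) v = 0}"

lemma linear_funpow: "Vector_Spaces.linear scl scl (T ^^ n)"
proof (induction n)
  case 0
  then show ?case
    by (simp add: id_def[symmetric] vs1.linear_id)
next
  case (Suc n)
  show ?case
    using Vector_Spaces.linear_compose[OF Suc linear_axioms] by (simp add: comp_def)
qed

lemma funpow_zero [simp]: "(T ^^ n) 0 = 0"
  by (induction n) simp_all

lemma funpow_eq_0_mono:
  assumes "(T ^^ m) v = 0" "m \<le> n"
  shows "(T ^^ n) v = 0"
  using assms by (metis comp_apply funpow_add funpow_zero le_add_diff_inverse2)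

lemma subspace_nil_part: "vs1.subspace nil_part"
proof (rule vs1.subspaceI)
  show "0 \<in> nil_part"
    unfolding nil_part_def by (auto intro: exI[of _ 0])
next
  fix x y assume "x \<in> nil_part" "y \<in> nil_part"
  then obtain m n where "(T ^^ m) x = 0" "(T ^^ n) y = 0"
    unfolding nil_part_def by blast
  then have "(T ^^ max m n) x = 0" "(T ^^ max m n) y = 0"
    by (auto intro: funpow_eq_0_mono)
  then have "(T ^^ max m n) (x + y) = 0"
    using linear_funpow[of "max m n", THEN module_hom_linearI, THEN module_hom.add] by simp
  then show "x + y \<in> nil_part"
    unfolding nil_part_def by blast
next
  fix c x assume "x \<in> nil_part"
  then obtain n where "(T ^^ n) x = 0"
    unfolding nil_part_def by blast
  then have "(T ^^ n) (scl c x) = 0"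
    using linear_funpow[of n, THEN module_hom_linearI, THEN module_hom.scale] by simp
  then show "scl c x \<in> nil_part"
    unfolding nil_part_def by blast
qed

lemma nil_partI:
  assumes "T v \<in> nil_part"
  shows "v \<in> nil_part"
proof -
  obtain n where "(T ^^ n) (T v) = 0"
    using assms unfolding nil_part_def by blast
  then have "(T ^^ Suc n) v = 0"
    by (simp add: funpow_swap1)
  then show ?thesis
    unfolding nil_part_def by blast
qed

lemma locally_nilpotent_iff_ker:
  "locally_nilpotent \<longleftrightarrow> UNIV = (\<Union>i\<in>{1..}. ker (T ^^ i))"
proof -
  \<comment> \<open>Local nilpotence admits exponent 0, the union of kernels starts at 1. An
    annihilating exponent can always be raised, so the two agree.\<close>
  have "(\<exists>n. (T ^^ n) v = 0) \<longleftrightarrow> (\<exists>n\<ge>1. (T ^^ n) v = 0)" for v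
    using funpow_eq_0_mono[of _ v] by (meson le_add1 le_add2)
  then show ?thesis
    unfolding locally_nilpotent_def ker_def by auto
qed

lemma locally_nilpotentI_basis:
  assumes "is_basis scl B" "B \<subseteq> nil_part"
  shows locally_nilpotent
proof -
  have "vs1.span B \<subseteq> nil_part"
    by (rule vs1.span_minimal[OF assms(2) subspace_nil_part])
  with assms(1) show ?thesis
    unfolding is_basis_def locally_nilpotent_def nil_part_def by auto
qed

section \<open>Convergence in the function topology\<close>

lemma zero_in_End: "(\<lambda>v. 0) \<in> End scl"
  by (simp add: End_def Vector_Spaces.linear_iff vs1.vector_space_axioms)

text \<open>Convergence to 0 means eventual vanishing on each finite-dimensional subspace. Lines
  suffice to detect local nilpotence; conversely, a finite spanning set has a common annihilating
  exponent.\<close>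

lemma topologically_nilpotent_iff:
  "topologically_nilpotent (function_topology scl) T \<longleftrightarrow> locally_nilpotent"
proof
  assume lim: "topologically_nilpotent (function_topology scl) T"
  show locally_nilpotent
    unfolding locally_nilpotent_def
  proof
    fix v
    let ?U = "{S \<in> End scl. \<forall>w\<in>vs1.span {v}. S w = 0}"
    have "fin_dim_subspace scl (vs1.span {v})"
      unfolding fin_dim_subspace_def using vs1.subspace_span by blast
    then have "function_topology_base scl ?U"
      unfolding function_topology_base_def by (intro bexI[OF _ zero_in_End] exI conjI) auto
    then have "openin (function_topology scl) ?U"
      unfolding openin_function_topology[OF vs1.vector_space_axioms] arbitrary_union_of_alt by blast
    then have "\<forall>\<^sub>F i in sequentially. T ^^ Suc i \<in> ?U"
      using lim zero_in_End unfolding topologically_nilpotent_def limitin_def by blast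
    then obtain i where "T ^^ Suc i \<in> ?U"
      unfolding eventually_sequentially by blast
    then have "(T ^^ Suc i) v = 0"
      using vs1.span_base by blast
    then show "\<exists>n. (T ^^ n) v = 0" ..
  qed
next
  assume nil: locally_nilpotent
  have "\<forall>\<^sub>F i in sequentially. T ^^ Suc i \<in> U"
    if U: "openin (function_topology scl) U" "(\<lambda>v. 0) \<in> U" for U
  proof -
    obtain U' where U': "function_topology_base scl U'" "(\<lambda>v. 0) \<in> U'" "U' \<subseteq> U"
      using U unfolding openin_function_topology[OF vs1.vector_space_axioms] arbitrary_union_of_alt
      by blast
    then obtain S W where W: "fin_dim_subspace scl W" "U' = {R \<in> End scl. \<forall>w\<in>W. R w = S w}"
      unfolding function_topology_base_def by blast
    \<comment> \<open>The zero map lies in \<open>U'\<close>, so the centre \<open>S\<close> may be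
      replaced by 0 on \<open>W\<close>.\<close>
    have S0: "\<forall>w\<in>W. S w = 0"
      using U'(2) W(2) by auto
    obtain X where X: "finite X" "vs1.span X = W"
      using W(1) unfolding fin_dim_subspace_def by blast
    have "\<forall>\<^sub>F i in sequentially. (T ^^ Suc i) x = 0" for x
    proof -
      obtain n where "(T ^^ n) x = 0"
        using nil unfolding locally_nilpotent_def by blast
      then have "\<forall>i\<ge>n. (T ^^ Suc i) x = 0"
        using funpow_eq_0_mono le_SucI by blast
      then show ?thesis
        unfolding eventually_sequentially by blast
    qed
    then have "\<forall>\<^sub>F i in sequentially. \<forall>x\<in>X. (T ^^ Suc i) x = 0"
      by (simp add: eventually_ball_finite X(1))
    then show ?thesis
    proof (rule eventually_mono)
      fix i assume 0: "\<forall>x\<in>X. (T ^^ Suc i) x = 0"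
      interpret P: module_hom scl scl "T ^^ Suc i"
        using linear_funpow by (rule module_hom_linearI)
      have "(T ^^ Suc i) w = 0" if "w \<in> W" for w
        using P.eq_0_on_span[of X w] 0 that X(2) by blast
      then have "T ^^ Suc i \<in> U'"
        using S0 W(2) linear_funpow by (simp add: End_def del: funpow.simps)
      with U'(3) show "T ^^ Suc i \<in> U" ..
    qed
  qed
  moreover have "(\<lambda>v. 0) \<in> topspace (function_topology scl)"
    unfolding topspace_function_topology[OF vs1.vector_space_axioms]
    by (rule zero_in_End)
  ultimately show "topologically_nilpotent (function_topology scl) T"
    unfolding topologically_nilpotent_def limitin_def by blast
qed

section \<open>Strict triangularity and local nilpotence\<close>

lemma strictly_triangular_imp_locally_nilpotent:
  assumes "well_ordered_basis scl B r" "strictly_triangular scl B r T"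
  shows locally_nilpotent
proof (rule locally_nilpotentI_basis)
  show "B \<subseteq> nil_part"
  proof
    fix v assume "v \<in> B"
    with assms(1) show "v \<in> nil_part"
    proof (induction v rule: well_ordered_basis_induct)
      case (less v)
      \<comment> \<open>By induction the earlier basis vectors lie in the subspace
        \<open>nil_part\<close>, hence so does \<open>T v\<close>, and one further power of
        \<open>T\<close> kills \<open>v\<close>.\<close>
      then have "vs1.span {u \<in> B. (u, v) \<in> r \<and> u \<noteq> v} \<subseteq> nil_part"
        by (intro vs1.span_minimal subspace_nil_part) blast
      moreover have "T v \<in> vs1.span {u \<in> B. (u, v) \<in> r \<and> u \<noteq> v}"
        using assms(2) less(1) unfolding strictly_triangular_def by blast
      ultimately show ?case
        using nil_partI by blast
    qed
  qed
qed (use assms(1) in \<open>simp add: well_ordered_basis_def\<close>)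

lemma locally_nilpotent_imp_strictly_triangularizable:
  assumes locally_nilpotent
  shows "strictly_triangularizable scl T"
proof -
  obtain B where B: "is_basis scl B" "\<And>n. ker (T ^^ n) \<subseteq> vs1.span (B \<inter> ker (T ^^ n))"
  proof (rule vs1.basis_of_filtration[of "\<lambda>n. ker (T ^^ n)"])
    show "ker (T ^^ n) \<subseteq> ker (T ^^ Suc n)" for n
      using funpow_eq_0_mono[of n _ "Suc n"] by (auto simp: ker_def simp del: funpow.simps)
    show "(\<Union>n. ker (T ^^ n)) = UNIV"
      using assms by (auto simp: locally_nilpotent_def ker_def)
  qed blast
  \<comment> \<open>The height is the first stage of the filtration containing \<open>v\<close>; it
    is the rank that the order on \<open>B\<close> will refine.\<close>
  define height where "height v = (LEAST n. (T ^^ n) v = 0)" for v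
  have height: "(T ^^ height v) v = 0" for v
    using assms unfolding locally_nilpotent_def height_def by (meson LeastI_ex)
  obtain r where r: "well_order_on B r"
    "\<And>u v. u \<in> B \<Longrightarrow> v \<in> B \<Longrightarrow> height u < height v \<Longrightarrow> (u, v) \<in> r"
    by (rule well_order_on_refine_rank[of B height]) blast
  have "T v \<in> vs1.span {u \<in> B. (u, v) \<in> r \<and> u \<noteq> v}" if v: "v \<in> B" for v
  proof -
    have "v \<noteq> 0"
      using v B(1) vs1.dependent_zero unfolding is_basis_def by blast
    \<comment> \<open>Only 0 has height 0, so the height of \<open>v\<close> has a predecessor
      \<open>n\<close>, and \<open>T v\<close> already lies in the kernel of
      \<open>T ^^ n\<close>.\<close>
    then obtain n where n: "height v = Suc n"
      using height[of v] by (cases "height v") auto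
    then have "(T ^^ n) (T v) = 0"
      using height[of v] by (simp add: funpow_swap1)
    then have "T v \<in> vs1.span (B \<inter> ker (T ^^ n))"
      using B(2)[of n] unfolding ker_def by blast
    \<comment> \<open>Basis vectors in this kernel have strictly smaller height than
      \<open>v\<close>, so they precede \<open>v\<close> and differ from it, however ties were
      broken.\<close>
    moreover have "B \<inter> ker (T ^^ n) \<subseteq> {u \<in> B. (u, v) \<in> r \<and> u \<noteq> v}"
    proof
      fix u assume u: "u \<in> B \<inter> ker (T ^^ n)"
      then have "height u \<le> n"
        unfolding height_def ker_def by (auto intro: Least_le)
      with n have "height u < height v"
        by simp
      with u v r(2) show "u \<in> {u \<in> B. (u, v) \<in> r \<and> u \<noteq> v}"
        by blast
    qed
    ultimately show ?thesis
      using vs1.span_mono by blast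
  qed
  then show ?thesis
    unfolding strictly_triangularizable_def strictly_triangular_def well_ordered_basis_def
    using B(1) r(1) by blast
qed

section \<open>Triangular maps and their diagonal coefficients\<close>

lemma strictly_triangular_imp_triangular:
  assumes "strictly_triangular scl B r T"
  shows "triangular scl B r T"
proof -
  have "vs1.span {u \<in> B. (u, v) \<in> r \<and> u \<noteq> v} \<subseteq> vs1.span {u \<in> B. (u, v) \<in> r}" for v
    by (rule vs1.span_mono) blast
  with assms show ?thesis
    unfolding strictly_triangular_def triangular_def by blast
qed

text \<open>Transitivity keeps the images of vectors strictly below \<open>v\<close> in the span of
  vectors below \<open>v\<close>; antisymmetry excludes a return to \<open>v\<close> itself.\<close>

lemma span_strictly_below_invariant:
  assumes "well_ordered_basis scl B r" "triangular scl B r T"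
    and x: "x \<in> vs1.span {u \<in> B. (u, v) \<in> r \<and> u \<noteq> v}"
  shows "T x \<in> vs1.span {u \<in> B. (u, v) \<in> r \<and> u \<noteq> v}"
proof -
  let ?S = "{u \<in> B. (u, v) \<in> r \<and> u \<noteq> v}"
  have "trans r" "antisym r"
    using assms(1) by (auto simp: well_ordered_basis_def order_on_defs)
  then have "{t \<in> B. (t, u) \<in> r} \<subseteq> ?S" if "u \<in> ?S" for u
    using that by (auto dest: transD antisymD)
  then have "T ` ?S \<subseteq> vs1.span ?S"
    using assms(2) vs1.span_mono unfolding triangular_def by blast
  then have "vs1.span (T ` ?S) \<subseteq> vs1.span ?S"
    using vs1.span_minimal by auto
  with x show ?thesis
    using span_image by blast
qed

text \<open>The scalar \<open>a\<close> is the diagonal entry of \<open>T\<close> at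
  \<open>v\<close>; strict triangularity amounts to its vanishing for every
  \<open>v\<close>.\<close>

lemma triangular_decomp:
  assumes "well_ordered_basis scl B r" "triangular scl B r T" "v \<in> B"
  obtains a where "T v - scl a v \<in> vs1.span {u \<in> B. (u, v) \<in> r \<and> u \<noteq> v}"
proof -
  have "T v \<in> vs1.span (insert v {u \<in> B. (u, v) \<in> r \<and> u \<noteq> v})"
    using assms(2,3) well_ordered_basis_insert[OF assms(1,3)] unfolding triangular_def by auto
  then show ?thesis
    using that unfolding vs1.span_breakdown_eq by blast
qed

lemma basis_notin_span_strictly_below:
  assumes "well_ordered_basis scl B r" "v \<in> B"
  shows "v \<notin> vs1.span {u \<in> B. (u, v) \<in> r \<and> u \<noteq> v}"
proof -
  have "{u \<in> B. (u, v) \<in> r \<and> u \<noteq> v} \<subseteq> B - {v}"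
    by blast
  then have "vs1.span {u \<in> B. (u, v) \<in> r \<and> u \<noteq> v} \<subseteq> vs1.span (B - {v})"
    by (rule vs1.span_mono)
  with assms show ?thesis
    unfolding well_ordered_basis_def is_basis_def vs1.dependent_def by blast
qed

text \<open>Modulo the invariant span of the vectors strictly below \<open>v\<close>,
  \<open>T\<close> multiplies \<open>v\<close> by its diagonal entry \<open>a\<close>, so
  \<open>T ^^ n\<close> multiplies it by \<open>a ^ n\<close>. If \<open>a\<close> were nonzero, an
  annihilating exponent would put \<open>v\<close> into that span, against independence.\<close>

lemma locally_nilpotent_triangular_imp_strictly:
  assumes locally_nilpotent "well_ordered_basis scl B r" "triangular scl B r T"
  shows "strictly_triangular scl B r T"
  unfolding strictly_triangular_def
proof
  fix v assume v: "v \<in> B"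
  let ?S = "vs1.span {u \<in> B. (u, v) \<in> r \<and> u \<noteq> v}"
  obtain a where a: "T v - scl a v \<in> ?S"
    using triangular_decomp[OF assms(2,3) v] .
  have pow: "(T ^^ n) v - scl (a ^ n) v \<in> ?S" for n
  proof (induction n)
    case 0
    then show ?case
      by (simp add: vs1.span_zero)
  next
    case (Suc n)
    have "(T ^^ Suc n) v - scl (a ^ Suc n) v =
        T ((T ^^ n) v - scl (a ^ n) v) + scl (a ^ n) (T v - scl a v)"
      by (simp add: diff scale vs1.scale_right_diff_distrib mult.commute)
    with span_strictly_below_invariant[OF assms(2,3) Suc] a show ?case
      by (simp only: vs1.span_add vs1.span_scale)
  qed
  obtain n where "(T ^^ n) v = 0"
    using assms(1) unfolding locally_nilpotent_def by blast
  with pow[of n] have "scl (a ^ n) v \<in> ?S"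
    using vs1.span_neg by fastforce
  then have "scl (inverse (a ^ n)) (scl (a ^ n) v) \<in> ?S"
    by (rule vs1.span_scale)
  then have "a = 0"
    using basis_notin_span_strictly_below[OF assms(2) v] by (cases "a = 0") auto
  with a show "T v \<in> ?S"
    by simp
qed

section \<open>Eigenvalues of triangular and locally nilpotent maps\<close>

lemma nilpotent_solve_shift:
  assumes S: "vs1.subspace S" "\<And>x. x \<in> S \<Longrightarrow> T x \<in> S" and "a \<noteq> 0"
  shows "w \<in> S \<Longrightarrow> (T ^^ n) w = 0 \<Longrightarrow> \<exists>s\<in>S. T s - scl a s = w"
proof (induction n arbitrary: w)
  case 0
  then show ?case
    using vs1.subspace_0[OF S(1)] by (auto intro: bexI[of _ 0])
next
  case (Suc n)
  then have "(T ^^ n) (T w) = 0"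
    by (simp add: funpow_swap1)
  with Suc.IH[of "T w"] S(2)[OF Suc.prems(1)]
  obtain s where s: "s \<in> S" "T s - scl a s = T w"
    by blast
  \<comment> \<open>Since \<open>T - a I\<close> sends \<open>s\<close> to \<open>T w\<close> and
    \<open>w\<close> to \<open>T w - a w\<close>, it sends \<open>s - w\<close> to
    \<open>a w\<close>; dividing by \<open>a\<close> solves for \<open>w\<close>.\<close>
  let ?t = "scl (inverse a) (s - w)"
  have "T s - T w = scl a s"
    using s(2) by (metis add_diff_cancel_left' diff_add_cancel)
  then have "T ?t - scl a ?t = w"
    using \<open>a \<noteq> 0\<close> by (simp add: scale diff)
  moreover have "?t \<in> S"
    using s(1) Suc.prems(1) S(1) by (simp add: vs1.subspace_diff vs1.subspace_scale)
  ultimately show ?case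
    by blast
qed

lemma triangular_no_eigenvalue_imp_locally_nilpotent:
  assumes wob: "well_ordered_basis scl B r" and tri: "triangular scl B r T"
    and eig: "\<And>a v. a \<noteq> 0 \<Longrightarrow> T v = scl a v \<Longrightarrow> v = 0"
  shows locally_nilpotent
proof (rule locally_nilpotentI_basis)
  show "B \<subseteq> nil_part"
  proof
    fix v assume "v \<in> B"
    with wob show "v \<in> nil_part"
    proof (induction v rule: well_ordered_basis_induct)
      case (less v)
      let ?S = "vs1.span {u \<in> B. (u, v) \<in> r \<and> u \<noteq> v}"
      have S: "?S \<subseteq> nil_part"
        using less.IH by (intro vs1.span_minimal subspace_nil_part) blast
      obtain a where a: "T v - scl a v \<in> ?S"
        using triangular_decomp[OF wob tri less.hyps] .
      have "a = 0"
      proof (rule ccontr)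
        assume "a \<noteq> 0"
        obtain n where "(T ^^ n) (T v - scl a v) = 0"
          using a S unfolding nil_part_def by blast
        then obtain s where s: "s \<in> ?S" "T s - scl a s = T v - scl a v"
          using nilpotent_solve_shift[of ?S a, OF vs1.subspace_span _ \<open>a \<noteq> 0\<close> a]
            span_strictly_below_invariant[OF wob tri] by blast
        then have "T (v - s) = scl a (v - s)"
          by (simp add: diff vs1.scale_right_diff_distrib algebra_simps)
        \<comment> \<open>Without nonzero eigenvalues \<open>v - s\<close> must vanish, which places
          \<open>v\<close> in the span of the vectors strictly below it.\<close>
        then have "v = s"
          using eig[OF \<open>a \<noteq> 0\<close>] by fastforce
        with s(1) show False
          using basis_notin_span_strictly_below[OF wob less.hyps] by blast
      qed
      with a S have "T v \<in> nil_part"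
        by auto
      then show ?case
        by (rule nil_partI)
    qed
  qed
qed (use wob in \<open>simp add: well_ordered_basis_def\<close>)

text \<open>The last nonzero vector among the iterates of a nonzero \<open>v\<close> lies in the
  kernel of \<open>T\<close>. Conversely, on an eigenvector for \<open>a\<close> the powers of
  \<open>T\<close> act as powers of \<open>a\<close>, so one of these must be 0.\<close>

lemma locally_nilpotent_eigenvalue_iff:
  assumes locally_nilpotent "\<exists>v::'v. v \<noteq> 0"
  shows "ker (\<lambda>v. T v - scl a v) \<noteq> {0} \<longleftrightarrow> a = 0"
proof
  assume "a = 0"
  obtain v :: 'v where "v \<noteq> 0"
    using assms(2) by blast
  have "\<exists>n. (T ^^ n) v = 0"
    using assms(1) unfolding locally_nilpotent_def by blast
  then obtain n where "\<forall>i<n. (T ^^ i) v \<noteq> 0" "(T ^^ n) v = 0"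
    using exists_least_iff[of "\<lambda>n. (T ^^ n) v = 0"] by blast
  \<comment> \<open>The least annihilating exponent \<open>n\<close> is positive because
    \<open>v\<close> is nonzero; \<open>m\<close> is its predecessor.\<close>
  with \<open>v \<noteq> 0\<close> obtain m where "(T ^^ m) v \<noteq> 0" "T ((T ^^ m) v) = 0"
    by (cases n) auto
  with \<open>a = 0\<close> show "ker (\<lambda>v. T v - scl a v) \<noteq> {0}"
    unfolding ker_def by auto
next
  assume "ker (\<lambda>v. T v - scl a v) \<noteq> {0}"
  moreover have "0 \<in> ker (\<lambda>v. T v - scl a v)"
    by (simp add: ker_def)
  ultimately obtain v where v: "v \<noteq> 0" "T v = scl a v"
    unfolding ker_def by auto
  have pow: "(T ^^ n) v = scl (a ^ n) v" for n
    by (induction n) (simp_all add: scale v(2) mult.commute)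
  obtain n where "(T ^^ n) v = 0"
    using assms(1) unfolding locally_nilpotent_def by blast
  with pow v(1) show "a = 0"
    by simp
qed

end

theorem proposition20:
  fixes scl :: "'k::field \<Rightarrow> 'v::ab_group_add \<Rightarrow> 'v"
    and T :: "'v \<Rightarrow> 'v"
  assumes "vector_space scl"
    and "\<exists>v::'v. v \<noteq> 0"
    and "T \<in> End scl"
  shows
    "(topologically_nilpotent (function_topology scl) T
        \<longleftrightarrow> (UNIV :: 'v set) = (\<Union>i\<in>{1..}. ker (T ^^ i)))
     \<and> (topologically_nilpotent (function_topology scl) T
        \<longleftrightarrow> strictly_triangularizable scl T)
     \<and> (topologically_nilpotent (function_topology scl) T
        \<longleftrightarrow> triangularizable scl T
          \<and> (\<forall>B r. well_ordered_basis scl B r \<and> triangular scl B r T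
                \<longrightarrow> strictly_triangular scl B r T))
     \<and> (topologically_nilpotent (function_topology scl) T
        \<longleftrightarrow> triangularizable scl T
          \<and> (\<forall>a::'k. ker (\<lambda>v. T v - scl a v) \<noteq> {0} \<longleftrightarrow> a = 0))"
proof -
  interpret endomorphism scl T
    using assms(3) by (simp add: endomorphism_def End_def)
  have 3: "locally_nilpotent \<longleftrightarrow> strictly_triangularizable scl T"
    using strictly_triangular_imp_locally_nilpotent locally_nilpotent_imp_strictly_triangularizable
    unfolding strictly_triangularizable_def by blast
  then have tri: "locally_nilpotent \<Longrightarrow> triangularizable scl T"
    using strictly_triangular_imp_triangular
    unfolding strictly_triangularizable_def triangularizable_def by blast
  \<comment> \<open>For the converse, triangularizability supplies one basis, and the second clause
    makes \<open>T\<close> strictly triangular there.\<close>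
  have 4: "locally_nilpotent \<longleftrightarrow> triangularizable scl T
      \<and> (\<forall>B r. well_ordered_basis scl B r \<and> triangular scl B r T \<longrightarrow> strictly_triangular scl B r T)"
    using tri locally_nilpotent_triangular_imp_strictly strictly_triangular_imp_locally_nilpotent
    unfolding triangularizable_def by blast
  have "locally_nilpotent"
    if "triangularizable scl T" "\<forall>a. ker (\<lambda>v. T v - scl a v) \<noteq> {0} \<longleftrightarrow> a = 0"
  proof -
    have "v = 0" if "a \<noteq> 0" "T v = scl a v" for a v
    proof -
      have "v \<in> ker (\<lambda>v. T v - scl a v)"
        using that(2) by (simp add: ker_def)
      with \<open>a \<noteq> 0\<close> \<open>\<forall>a. _\<close> show ?thesis
        by blast
    qed
    with that(1) show ?thesis
      using triangular_no_eigenvalue_imp_locally_nilpotent unfolding triangularizable_def by blast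
  qed
  then have 5: "locally_nilpotent \<longleftrightarrow> triangularizable scl T
      \<and> (\<forall>a. ker (\<lambda>v. T v - scl a v) \<noteq> {0} \<longleftrightarrow> a = 0)"
    using tri locally_nilpotent_eigenvalue_iff assms(2) by blast
  show ?thesis
    unfolding topologically_nilpotent_iff
    using locally_nilpotent_iff_ker 3 4 5 by blast
qed

end
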